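(* Let $f_1$ be any non-constant polynomial with $f_1'\ge 0$ on $[a,b]$. Then: (1) For every $N$ sufficiently large there is a generalized Bernstein operator $B_N^{f_1}$ based on $\mathbb{P}_N[a,b]$, which fixes both $\mathbf{1}$ and $f_1$. (2) If there exists an $x_0\in(a,b)$ such that $f_1'(x_0)=0$, the sequence of nodes fails to be non-decreasing for all $N$ such that $B_N^{f_1}$ exists. Fix $N$ large enough so that $B_N^{f_1}$ is well defined. Then: (3) If $f_1'$ has a zero of order $s_1$ at $a$, the first $s_1+1$ nodes are equal to $a$; and if $f_1'$ has a zero of order $s_2$ at $b$, the last $s_2+1$ nodes are equal to $b$. (4) If $f_1'>0$ on $(a,b)$, then the nodes in $(a,b)$ form a strictly increasing sequence. (5) If $f_1'>0$ on $[a,b]$, then all nodes form a strictly increasing sequence.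
   Context: Here $a<b$ are real numbers, polynomials are real, and $\mathbb{P}_N[a,b]$ is the space of polynomials of degree at most $N$ on $[a,b]$, with the standard Bernstein basis $p_{N,k}(x)=\binom{N}{k}\frac{(x-a)^k(b-x)^{N-k}}{(b-a)^N}$, $k=0,\dots,N$. A generalized Bernstein operator $B_N:C[a,b]\to\mathbb{P}_N[a,b]$ is an operator of the form $B_Nf=\sum_{k=0}^N f(t_{N,k})\,\alpha_{N,k}\,p_{N,k}$ with nodes $t_{N,0},\dots,t_{N,N}\in[a,b]$ (not required to be ordered) and positive weights $\alpha_{N,k}$. It fixes $g$ if $B_Ng=g$; $\mathbf{1}$ is the constant function $1$. For a polynomial $f_1\in\mathbb{P}_N[a,b]$ strictly increasing on $[a,b]$, write $f_1=\sum_{k=0}^N\gamma_{N,k}p_{N,k}$. There is at most one generalized Bernstein operator on $\mathbb{P}_N[a,b]$ fixing $\mathbf{1}$ and $f_1$; it is denoted $B_N^{f_1}$, and it is said to be well defined when it exists. In that case its weights are $\alpha_{N,k}=1$ and its nodes are $t_{N,k}=f_1^{-1}(\gamma_{N,k})$. The sequence of nodes is taken in the order of the index $k=0,\dots,N$; it is non-decreasing if $t_{N,0}\le t_{N,1}\le\dots\le t_{N,N}$, and strictly increasing if all these inequalities are strict.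
   Formalization: Items (4) and (5) are stated for all sufficiently large N, not for every N for which the operator is well defined; the latter fails on [0,1] for N=3 with Bernstein coefficients 0, 0.6, 0.4, 1. *)

theory Defs
  imports "HOL-Analysis.Analysis" "HOL-Computational_Algebra.Polynomial"
begin

definition bernstein_basis :: "real \<Rightarrow> real \<Rightarrow> nat \<Rightarrow> nat \<Rightarrow> real \<Rightarrow> real" where
  "bernstein_basis a b N k x =
     real (N choose k) * ((x - a) ^ k * (b - x) ^ (N - k)) / (b - a) ^ N"

text \<open>
  The space \<open>C[a,b]\<close> is rendered by functions on the reals that are continuous on \<open>{a..b}\<close>;
  only the values on \<open>{a..b}\<close> of an image \<open>B f\<close> are constrained. The formula makes every such
  image agree on \<open>{a..b}\<close> with a polynomial of degree at most \<open>N\<close>. Only \<open>t k\<close> and \<open>\<alpha> k\<close> with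
  \<open>k \<le> N\<close> are relevant.
\<close>

definition gen_bernstein_op ::
  "real \<Rightarrow> real \<Rightarrow> nat \<Rightarrow> ((real \<Rightarrow> real) \<Rightarrow> (real \<Rightarrow> real)) \<Rightarrow> (nat \<Rightarrow> real) \<Rightarrow> (nat \<Rightarrow> real) \<Rightarrow> bool"
where
  "gen_bernstein_op a b N B t \<alpha> \<longleftrightarrow>
     (\<forall>k\<le>N. t k \<in> {a..b} \<and> \<alpha> k > 0) \<and>
     (\<forall>f. continuous_on {a..b} f \<longrightarrow>
        (\<forall>x\<in>{a..b}. B f x = (\<Sum>k\<le>N. f (t k) * \<alpha> k * bernstein_basis a b N k x)))"

definition op_fixes ::
  "real \<Rightarrow> real \<Rightarrow> ((real \<Rightarrow> real) \<Rightarrow> (real \<Rightarrow> real)) \<Rightarrow> (real \<Rightarrow> real) \<Rightarrow> bool" where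
  "op_fixes a b B g \<longleftrightarrow> (\<forall>x\<in>{a..b}. B g x = g x)"

text \<open>
  \<open>B\<close> is the operator \<open>B\<^sub>N\<^sup>f\<close>, and \<open>t 0, \<dots>, t N\<close> are its nodes. A predicate is used
  because the operator need not exist. The weights and nodes are determined by \<open>B\<close>: the basis
  is linearly independent, so \<open>B\<close> determines \<open>f (t k) * \<alpha> k\<close> for every continuous \<open>f\<close>.
\<close>

definition is_bernstein_fixing ::
  "real \<Rightarrow> real \<Rightarrow> nat \<Rightarrow> real poly \<Rightarrow> ((real \<Rightarrow> real) \<Rightarrow> (real \<Rightarrow> real)) \<Rightarrow> (nat \<Rightarrow> real) \<Rightarrow> bool"
where
  "is_bernstein_fixing a b N f B t \<longleftrightarrow>
     (\<exists>\<alpha>. gen_bernstein_op a b N B t \<alpha>) \<and>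
     op_fixes a b B (\<lambda>_. 1) \<and> op_fixes a b B (poly f)"

end

theory Submission
  imports Defs
begin

text \<open>
  An operator that fixes \<open>1\<close> has all weights equal to \<open>1\<close>, because the Bernstein basis is linearly
  independent; fixing \<open>f\<^sub>1\<close> then says exactly that \<open>f\<^sub>1 (t k)\<close> is the \<open>k\<close>-th Bernstein coefficient
  of \<open>f\<^sub>1\<close> (\<open>is_bernstein_fixing_iff\<close>). As \<open>f\<^sub>1\<close> is strictly increasing on \<open>[a,b]\<close>, every claim
  about nodes becomes a claim about the Bernstein coefficients \<open>\<gamma>\<^sub>0, \<dots>, \<gamma>\<^sub>N\<close> of \<open>f\<^sub>1\<close>: the operator
  exists if and only if they all lie in \<open>[f\<^sub>1 a, f\<^sub>1 b]\<close>, and the nodes are ordered as the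
  coefficients are.

  The main tool is a version of Bernstein's theorem that allows zeros at the endpoints
  (\<open>bernstein_coeffs_pos_interior\<close>): if \<open>q > 0\<close> on \<open>(a,b)\<close> vanishes to order \<open>s\<close> at \<open>a\<close> and \<open>t\<close> at
  \<open>b\<close>, then for large \<open>N\<close> its coefficients are nonnegative, and positive for \<open>s \<le> k \<le> N - t\<close>. To see
  this, write \<open>q = (x - a)\<^sup>s (b - x)\<^sup>t h\<close> with \<open>h > 0\<close> on \<open>[a,b]\<close>. The degree-\<open>M\<close> coefficients of \<open>h\<close>
  approach the values \<open>h (a + (b - a) k / M)\<close> uniformly in \<open>k\<close>, so they are eventually positive; and
  multiplication by \<open>(x - a)\<^sup>s (b - x)\<^sup>t\<close> only shifts and positively rescales coefficients.

  Applied to \<open>f\<^sub>1 - f\<^sub>1 a\<close> and \<open>f\<^sub>1 b - f\<^sub>1\<close>, this yields existence. The coefficients of \<open>f\<^sub>1'\<close> are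
  positive multiples of the differences \<open>\<gamma>\<^bsub>k+1\<^esub> - \<gamma>\<^sub>k\<close> (\<open>pderiv_bernstein_comb\<close>), so applying it to \<open>f\<^sub>1'\<close>
  yields the strict monotonicity claims. The same formula shows that non-decreasing coefficients
  would force \<open>f\<^sub>1' > 0\<close> on \<open>(a,b)\<close>, so an interior zero of \<open>f\<^sub>1'\<close> excludes non-decreasing nodes.
  Finally, a zero of order \<open>s\<close> of \<open>f\<^sub>1'\<close> at \<open>a\<close> is a zero of order \<open>s + 1\<close> of \<open>f\<^sub>1 - f\<^sub>1 a\<close>, which
  annihilates the first \<open>s + 1\<close> coefficients of that polynomial; exchanging \<open>a\<close> and \<open>b\<close> gives the
  claim at \<open>b\<close>.
\<close>

section \<open>Polynomials in Bernstein form\<close>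

text \<open>
  The Bernstein basis function as a polynomial. The endpoints need not satisfy \<open>a < b\<close>: several
  lemmas assume only \<open>a \<noteq> b\<close>, so that they can also be used with the endpoints exchanged.
\<close>

definition bernstein_poly :: "real \<Rightarrow> real \<Rightarrow> nat \<Rightarrow> nat \<Rightarrow> real poly" where
  "bernstein_poly a b N k =
     smult (real (N choose k) / (b - a) ^ N) ([:-a, 1:] ^ k * [:b, -1:] ^ (N - k))"

text \<open>
  The polynomial whose coefficients in the Bernstein basis of degree \<open>N\<close> are \<open>c 0, \<dots>, c N\<close>; the
  values of \<open>c\<close> beyond \<open>N\<close> are irrelevant.
\<close>

definition bernstein_comb :: "real \<Rightarrow> real \<Rightarrow> nat \<Rightarrow> (nat \<Rightarrow> real) \<Rightarrow> real poly" where
  "bernstein_comb a b N c = (\<Sum>k\<le>N. smult (c k) (bernstein_poly a b N k))"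

lemma poly_bernstein_poly: "poly (bernstein_poly a b N k) x = bernstein_basis a b N k x"
  by (simp add: bernstein_poly_def bernstein_basis_def algebra_simps)

lemma poly_bernstein_comb:
  "poly (bernstein_comb a b N c) x = (\<Sum>k\<le>N. c k * bernstein_basis a b N k x)"
  by (simp add: bernstein_comb_def poly_sum poly_bernstein_poly)

lemma bernstein_basis_pos:
  assumes "a < x" "x < b" "k \<le> N"
  shows "bernstein_basis a b N k x > 0"
  using assms by (simp add: bernstein_basis_def)

lemma bernstein_comb_cong:
  "(\<And>k. k \<le> N \<Longrightarrow> c k = d k) \<Longrightarrow> bernstein_comb a b N c = bernstein_comb a b N d"
  by (simp add: bernstein_comb_def)

lemma bernstein_comb_diff:
  "bernstein_comb a b N (\<lambda>k. c k - d k) = bernstein_comb a b N c - bernstein_comb a b N d"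
  by (simp add: bernstein_comb_def smult_diff_left sum_subtractf)

lemma bernstein_comb_scale:
  "bernstein_comb a b N (\<lambda>k. r * c k) = smult r (bernstein_comb a b N c)"
  by (rule poly_ext) (simp add: poly_bernstein_comb sum_distrib_left mult.assoc)

lemma bernstein_comb_sum:
  "bernstein_comb a b N (\<lambda>k. \<Sum>j\<in>J. c j k) = (\<Sum>j\<in>J. bernstein_comb a b N (c j))"
  by (rule poly_ext) (simp add: poly_bernstein_comb poly_sum sum_distrib_right sum.swap[of _ "{..N}"])

lemma bernstein_basis_swap:
  assumes "k \<le> N"
  shows "bernstein_basis a b N (N - k) x = bernstein_basis b a N k x"
proof -
  have "(x - a) ^ (N - k) = (-1) ^ (N - k) * (a - x) ^ (N - k)"
    by (simp flip: power_mult_distrib)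
  moreover have "(b - x) ^ k = (-1) ^ k * (x - b) ^ k"
    by (simp flip: power_mult_distrib)
  moreover have "(b - a) ^ N = (-1) ^ (N - k) * (-1) ^ k * (a - b) ^ N"
    using assms by (simp flip: power_mult_distrib power_add)
  ultimately show ?thesis
    using assms by (simp add: bernstein_basis_def binomial_symmetric[OF assms] field_simps)
qed

lemma bernstein_comb_swap:
  "bernstein_comb a b N c = bernstein_comb b a N (\<lambda>k. c (N - k))"
proof (rule poly_ext)
  fix x
  have "(\<Sum>k\<le>N. c k * bernstein_basis a b N k x)
      = (\<Sum>k\<le>N. c (N - k) * bernstein_basis a b N (N - k) x)"
    by (rule sum.reindex_bij_witness[of _ "\<lambda>k. N - k" "\<lambda>k. N - k"]) auto
  then show "poly (bernstein_comb a b N c) x = poly (bernstein_comb b a N (\<lambda>k. c (N - k))) x"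
    by (simp add: poly_bernstein_comb bernstein_basis_swap)
qed

section \<open>Vanishing at an endpoint and uniqueness of coefficients\<close>

text \<open>
  The first nonzero coefficient \<open>c k\<close> is visible as the order of vanishing at \<open>a\<close>, because all later
  basis polynomials vanish at \<open>a\<close> to an order larger than \<open>k\<close>. Linear independence of the basis is the case in
  which the combination is \<open>0\<close>, which is divisible by every power.
\<close>

lemma bernstein_comb_coeff_eq_0:
  assumes "a \<noteq> b" and dvd: "[:-a, 1:] ^ m dvd bernstein_comb a b N c" and "k < m" "k \<le> N"
  shows "c k = 0"
  using \<open>k < m\<close> \<open>k \<le> N\<close>
proof (induction k rule: less_induct)
  case (less k)
  let ?X = "[:-a, 1:]"
  \<comment> \<open>By induction all terms before \<open>k\<close> vanish, so \<open>?X ^ k\<close> can be factored out.\<close>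
  define w where "w j = c j * (real (N choose j) / (b - a) ^ N)" for j
  define R where "R = (\<Sum>j\<in>{k..N}. smult (w j) (?X ^ (j - k) * [:b, -1:] ^ (N - j)))"
  have "bernstein_comb a b N c = (\<Sum>j\<le>N. smult (w j) (?X ^ j * [:b, -1:] ^ (N - j)))"
    by (simp add: bernstein_comb_def bernstein_poly_def w_def)
  also have "\<dots> = (\<Sum>j\<in>{k..N}. smult (w j) (?X ^ j * [:b, -1:] ^ (N - j)))"
    using less by (intro sum.mono_neutral_right) (auto simp: w_def not_le)
  also have "\<dots> = (\<Sum>j\<in>{k..N}. ?X ^ k * smult (w j) (?X ^ (j - k) * [:b, -1:] ^ (N - j)))"
  proof (rule sum.cong)
    fix j assume "j \<in> {k..N}"
    then have "?X ^ j = ?X ^ k * ?X ^ (j - k)"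
      by (simp flip: power_add)
    then show "smult (w j) (?X ^ j * [:b, -1:] ^ (N - j))
      = ?X ^ k * smult (w j) (?X ^ (j - k) * [:b, -1:] ^ (N - j))"
      by (simp add: mult.assoc)
  qed simp
  also have "\<dots> = ?X ^ k * R"
    by (simp add: R_def sum_distrib_left)
  finally have "?X ^ Suc k dvd ?X ^ k * R"
    using dvd less.prems(1) by (metis Suc_leI power_le_dvd)
  then have "?X dvd R"
    unfolding power_Suc2 dvd_mult_cancel_left by simp
  then have "poly R a = 0"
    by (simp add: poly_eq_0_iff_dvd)
  moreover have "poly R a = (\<Sum>j\<in>{k..N}. if j = k then w k * (b - a) ^ (N - k) else 0)"
    unfolding R_def poly_sum by (intro sum.cong) auto
  ultimately have "w k * (b - a) ^ (N - k) = 0"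
    using less.prems by simp
  then show ?case
    using assms(1) less.prems by (simp add: w_def)
qed

lemma bernstein_comb_unique:
  assumes "a \<noteq> b" "bernstein_comb a b N c = bernstein_comb a b N d" "k \<le> N"
  shows "c k = d k"
proof -
  have "bernstein_comb a b N (\<lambda>k. c k - d k) = 0"
    using assms(2) by (simp add: bernstein_comb_diff)
  then show ?thesis
    using bernstein_comb_coeff_eq_0[of a b "Suc N" N "\<lambda>k. c k - d k" k] assms by auto
qed

section \<open>Bernstein's theorem on positive coefficients\<close>

text \<open>
  With \<open>u = (x - a) / (b - a)\<close> and \<open>v = 1 - u\<close>, this is the binomial expansion of
  \<open>u ^ j * (u + v) ^ (N - j)\<close>.
\<close>

lemma bernstein_comb_power:
  assumes "a \<noteq> b" "j \<le> N"
  shows "bernstein_comb a b N (\<lambda>k. real (k choose j) / real (N choose j))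
       = [:-a / (b - a), 1 / (b - a):] ^ j"
proof (rule poly_ext)
  fix x
  define u v where "u = (x - a) / (b - a)" and "v = (b - x) / (b - a)"
  have uv: "u + v = 1"
    using assms(1) by (simp add: u_def v_def flip: add_divide_distrib)
  have basis: "bernstein_basis a b N k x = real (N choose k) * (u ^ k * v ^ (N - k))"
    if "k \<le> N" for k
  proof -
    have "(b - a) ^ N = (b - a) ^ k * (b - a) ^ (N - k)"
      using that by (simp flip: power_add)
    then show ?thesis
      by (simp add: bernstein_basis_def u_def v_def power_divide)
  qed
  have "poly (bernstein_comb a b N (\<lambda>k. real (k choose j) / real (N choose j))) x
      = (\<Sum>k\<in>{j..N}. real (k choose j) / real (N choose j) * bernstein_basis a b N k x)"
    unfolding poly_bernstein_comb by (intro sum.mono_neutral_right) auto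
  also have "\<dots> = (\<Sum>k\<in>{j..N}. u ^ j * (real ((N - j) choose (k - j)) * u ^ (k - j) * v ^ (N - k)))"
  proof (rule sum.cong)
    fix k assume k: "k \<in> {j..N}"
    have "real (N choose k) * real (k choose j) = real (N choose j) * real ((N - j) choose (k - j))"
      using k choose_mult[of j k N] by (simp flip: of_nat_mult)
    moreover have "u ^ k = u ^ j * u ^ (k - j)"
      using k by (simp flip: power_add)
    ultimately show "real (k choose j) / real (N choose j) * bernstein_basis a b N k x
      = u ^ j * (real ((N - j) choose (k - j)) * u ^ (k - j) * v ^ (N - k))"
      using k assms(2) by (simp add: basis field_simps)
  qed simp
  also have "\<dots> = (\<Sum>i\<le>N - j. u ^ j * (real ((N - j) choose i) * u ^ i * v ^ (N - j - i)))"
    by (rule sum.reindex_bij_witness[of _ "\<lambda>i. i + j" "\<lambda>k. k - j"]) (use assms(2) in auto)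
  also have "\<dots> = u ^ j * (u + v) ^ (N - j)"
    by (simp add: binomial_ring sum_distrib_left)
  finally show "poly (bernstein_comb a b N (\<lambda>k. real (k choose j) / real (N choose j))) x
      = poly ([:-a / (b - a), 1 / (b - a):] ^ j) x"
    using uv by (simp add: u_def diff_divide_distrib)
qed

lemma bernstein_comb_const:
  assumes "a \<noteq> b"
  shows "bernstein_comb a b N (\<lambda>_. r) = [:r:]"
  using bernstein_comb_power[OF assms, of 0 N] bernstein_comb_scale[of a b N r "\<lambda>_. 1"]
  by simp

lemma bernstein_comb_rep:
  assumes "a \<noteq> b" "degree q \<le> N"
  shows "q = bernstein_comb a b N (\<lambda>k. \<Sum>j\<le>degree q.
           coeff (q \<circ>\<^sub>p [:a, b - a:]) j * (real (k choose j) / real (N choose j)))"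
proof (rule poly_ext)
  fix x
  let ?e = "coeff (q \<circ>\<^sub>p [:a, b - a:])"
  have "degree (q \<circ>\<^sub>p [:a, b - a:]) = degree q"
    using assms(1) by (simp add: degree_pcompose)
  then have "poly (q \<circ>\<^sub>p [:a, b - a:]) ((x - a) / (b - a))
      = (\<Sum>j\<le>degree q. ?e j * ((x - a) / (b - a)) ^ j)"
    by (simp only: poly_altdef)
  then have "poly q x = (\<Sum>j\<le>degree q. ?e j * ((x - a) / (b - a)) ^ j)"
    using assms(1) by (simp add: poly_pcompose)
  also have "\<dots> = poly (bernstein_comb a b N (\<lambda>k. \<Sum>j\<le>degree q.
                    ?e j * (real (k choose j) / real (N choose j)))) x"
    using assms by (simp add: bernstein_comb_sum bernstein_comb_scale bernstein_comb_power
        poly_sum diff_divide_distrib del: times_divide_eq_right) simp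
  finally show "poly q x = \<dots>" .
qed

text \<open>
  The degree-\<open>N\<close> coefficients of \<open>u ^ j\<close> converge to its values at \<open>k / N\<close>, uniformly in \<open>k\<close>. The step
  from \<open>j\<close> to \<open>j + 1\<close> multiplies the ratio by \<open>(k - j) / (N - j)\<close>, which differs from \<open>k / N\<close> by at most
  \<open>j / (N - j)\<close>.
\<close>

lemma choose_ratio_approx:
  fixes e :: real
  assumes "e > 0"
  shows "\<forall>\<^sub>F N in sequentially. \<forall>k\<le>N.
           \<bar>real (k choose j) / real (N choose j) - (real k / real N) ^ j\<bar> < e"
  using assms
proof (induction j arbitrary: e)
  case 0
  then show ?case by simp
next
  case (Suc j)
  have "\<forall>\<^sub>F N in sequentially. real j + 2 * real j / e < real N"
    using filterlim_real_sequentially by (simp add: filterlim_at_top_dense)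
  then have "\<forall>\<^sub>F N in sequentially. real j / (real N - real j) < e / 2"
    using eventually_gt_at_top[of j]
    by eventually_elim (use Suc.prems in \<open>simp add: field_simps\<close>)
  moreover have "\<forall>\<^sub>F N in sequentially. \<forall>k\<le>N.
      \<bar>real (k choose j) / real (N choose j) - (real k / real N) ^ j\<bar> < e / 2"
    using Suc.prems by (intro Suc.IH) simp
  ultimately show ?case
    using eventually_gt_at_top[of j]
  proof eventually_elim
    case (elim N)
    show ?case
    proof (intro allI impI)
      fix k assume k: "k \<le> N"
      define r where "r = real (k choose j) / real (N choose j)"
      define s where "s = (real k - real j) / (real N - real j)"
      define u where "u = real k / real N"
      have N: "real j < real N" "0 < real N"
        using elim by simp_all
      have step: "real (n choose Suc j) * real (Suc j) = real (n choose j) * (real n - real j)" for n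
      proof (cases "j \<le> n")
        case True
        have "(n choose Suc j) * Suc j = (n choose j) * (n - j)"
          by (metis binomial_absorb_comp binomial_absorption mult.commute)
        then show ?thesis
          using True by (metis of_nat_diff of_nat_mult)
      qed (simp add: binomial_eq_0)
      have "real (k choose Suc j) / real (N choose Suc j)
          = (real (k choose Suc j) * real (Suc j)) / (real (N choose Suc j) * real (Suc j))"
        by simp
      also have "\<dots> = r * s"
        unfolding step by (simp add: r_def s_def)
      finally have eq: "real (k choose Suc j) / real (N choose Suc j) = r * s" .
      have "k choose j \<le> N choose j"
        using k by (rule binomial_right_mono)
      then have r: "0 \<le> r" "r \<le> 1"
        using elim by (simp_all add: r_def)
      have u: "0 \<le> u" "u \<le> 1"
        using k N by (simp_all add: u_def)
      have "u - s = (1 - u) * (real j / (real N - real j))"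
        using N by (simp add: u_def s_def field_simps)
      then have "\<bar>s - u\<bar> = (1 - u) * (real j / (real N - real j))"
        using u N by (subst abs_minus_commute) (simp add: abs_mult)
      also have "\<dots> \<le> 1 * (real j / (real N - real j))"
        using u N by (intro mult_right_mono) auto
      also have "\<dots> < e / 2"
        using elim by simp
      finally have su: "\<bar>s - u\<bar> < e / 2" .
      have ru: "\<bar>r - u ^ j\<bar> < e / 2"
        using elim k by (simp add: r_def u_def)
      have "r * s - u ^ Suc j = r * (s - u) + (r - u ^ j) * u"
        by (simp add: algebra_simps)
      also have "\<bar>\<dots>\<bar> \<le> r * \<bar>s - u\<bar> + \<bar>r - u ^ j\<bar> * u"
        using r u by (metis abs_mult abs_of_nonneg abs_triangle_ineq)
      also have "\<dots> \<le> \<bar>s - u\<bar> + \<bar>r - u ^ j\<bar>"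
        using r u by (intro add_mono mult_left_le_one_le mult_right_le_one_le) auto
      finally show "\<bar>real (k choose Suc j) / real (N choose Suc j) - (real k / real N) ^ Suc j\<bar> < e"
        using su ru unfolding eq u_def by linarith
    qed
  qed
qed

lemma bernstein_coeffs_pos:
  assumes "a < b" and pos: "\<And>x. x \<in> {a..b} \<Longrightarrow> poly q x > 0"
  shows "\<forall>\<^sub>F N in sequentially. \<exists>c. q = bernstein_comb a b N c \<and> (\<forall>k\<le>N. c k > 0)"
proof -
  have "continuous_on {a..b} (poly q)"
    by (intro continuous_intros)
  then obtain z where z: "z \<in> {a..b}" "\<And>x. x \<in> {a..b} \<Longrightarrow> poly q z \<le> poly q x"
    using continuous_attains_inf[of "{a..b}" "poly q"] assms(1) by auto
  define m where "m = poly q z"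
  have m: "m > 0"
    using pos z(1) by (simp add: m_def)
  \<comment> \<open>The numbers \<open>?e j\<close> are the coefficients of \<open>q\<close> in powers of \<open>(x - a) / (b - a)\<close>. Approximating
    each power to within \<open>m / (E + 1)\<close> keeps the total error below \<open>m\<close>, the minimum of \<open>q\<close>.\<close>
  let ?e = "coeff (q \<circ>\<^sub>p [:a, b - a:])"
  define E where "E = (\<Sum>j\<le>degree q. \<bar>?e j\<bar>)"
  have E: "E \<ge> 0"
    by (simp add: E_def sum_nonneg)
  let ?c = "\<lambda>N k. \<Sum>j\<le>degree q. ?e j * (real (k choose j) / real (N choose j))"
  have "\<forall>\<^sub>F N in sequentially. \<forall>j\<in>{..degree q}. \<forall>k\<le>N.
      \<bar>real (k choose j) / real (N choose j) - (real k / real N) ^ j\<bar> < m / (E + 1)"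
    using m E by (intro eventually_ball_finite ballI choose_ratio_approx) auto
  then show ?thesis
    using eventually_ge_at_top[of "degree q"] eventually_gt_at_top[of 0]
  proof eventually_elim
    case (elim N)
    have "?c N k > 0" if k: "k \<le> N" for k
    proof -
      define u where "u = real k / real N"
      have u: "0 \<le> u" "u \<le> 1"
        using k elim by (simp_all add: u_def)
      have "degree (q \<circ>\<^sub>p [:a, b - a:]) = degree q"
        using assms(1) by (simp add: degree_pcompose)
      then have "poly (q \<circ>\<^sub>p [:a, b - a:]) u = (\<Sum>j\<le>degree q. ?e j * u ^ j)"
        by (simp only: poly_altdef)
      then have val: "poly q (a + (b - a) * u) = (\<Sum>j\<le>degree q. ?e j * u ^ j)"
        by (simp add: poly_pcompose mult.commute)
      have "(b - a) * u \<le> (b - a) * 1"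
        using u assms(1) by (intro mult_left_mono) auto
      then have "a + (b - a) * u \<in> {a..b}"
        using u assms(1) unfolding atLeastAtMost_iff by (smt (verit) mult_nonneg_nonneg mult.right_neutral)
      then have ge: "poly q (a + (b - a) * u) \<ge> m"
        using z(2) by (simp add: m_def)
      have "\<bar>poly q (a + (b - a) * u) - ?c N k\<bar>
          = \<bar>\<Sum>j\<le>degree q. ?e j * (u ^ j - real (k choose j) / real (N choose j))\<bar>"
        unfolding val by (simp add: sum_subtractf right_diff_distrib)
      also have "\<dots> \<le> (\<Sum>j\<le>degree q. \<bar>?e j\<bar> * (m / (E + 1)))"
      proof (rule order_trans[OF sum_abs], rule sum_mono)
        fix j assume "j \<in> {..degree q}"
        then have "\<bar>u ^ j - real (k choose j) / real (N choose j)\<bar> \<le> m / (E + 1)"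
          using elim(1) k unfolding u_def by (subst abs_minus_commute) (simp add: less_imp_le)
        then show "\<bar>?e j * (u ^ j - real (k choose j) / real (N choose j))\<bar> \<le> \<bar>?e j\<bar> * (m / (E + 1))"
          by (simp only: abs_mult) (rule mult_left_mono, auto)
      qed
      also have "\<dots> = E * (m / (E + 1))"
        by (simp only: E_def sum_distrib_right)
      also have "\<dots> < m"
        using m E by (simp add: field_simps)
      finally show ?thesis
        using ge by linarith
    qed
    then show ?case
      using bernstein_comb_rep[of a b q N] assms(1) elim by (intro exI[of _ "?c N"]) auto
  qed
qed

section \<open>Zeros at the endpoints\<close>

text \<open>
  Multiplication by \<open>(x - a) ^ s * (b - x) ^ t\<close> sends the basis polynomial with index \<open>k\<close> in degree \<open>N\<close>
  to a positive multiple of the one with index \<open>k + s\<close> in degree \<open>N + s + t\<close>.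
\<close>

lemma bernstein_comb_mult:
  assumes "a < b" and pos: "\<And>k. k \<le> N \<Longrightarrow> c k > 0"
  shows "\<exists>d. [:-a, 1:] ^ s * [:b, -1:] ^ t * bernstein_comb a b N c = bernstein_comb a b (N + s + t) d
           \<and> (\<forall>k\<le>N + s + t. 0 \<le> d k)
           \<and> (\<forall>k. s \<le> k \<longrightarrow> k + t \<le> N + s + t \<longrightarrow> 0 < d k)"
proof -
  define M where "M = N + s + t"
  define d where "d k = (if s \<le> k \<and> k \<le> N + s
     then c (k - s) * real (N choose (k - s)) * (b - a) ^ (s + t) / real (M choose k) else 0)" for k
  have "[:-a, 1:] ^ s * [:b, -1:] ^ t * bernstein_comb a b N c = bernstein_comb a b M d"
  proof (rule poly_ext)
    fix x
    have "poly (bernstein_comb a b M d) x = (\<Sum>k\<in>{s..N + s}. d k * bernstein_basis a b M k x)"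
      unfolding poly_bernstein_comb by (intro sum.mono_neutral_right) (auto simp: M_def d_def)
    also have "\<dots> = (\<Sum>k\<le>N. d (k + s) * bernstein_basis a b M (k + s) x)"
      by (rule sum.reindex_bij_witness[of _ "\<lambda>k. k + s" "\<lambda>k. k - s"]) auto
    also have "\<dots> = (\<Sum>k\<le>N. (x - a) ^ s * (b - x) ^ t * (c k * bernstein_basis a b N k x))"
    proof (rule sum.cong)
      fix k assume "k \<in> {..N}"
      then have k: "k \<le> N" by simp
      then have "M choose (k + s) > 0"
        by (simp add: M_def)
      moreover have "M - (k + s) = (N - k) + t"
        using k by (simp add: M_def)
      then have "(b - x) ^ (M - (k + s)) = (b - x) ^ (N - k) * (b - x) ^ t"
        by (simp only: power_add)
      moreover have "(b - a) ^ M = (b - a) ^ N * (b - a) ^ (s + t)"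
        by (simp add: M_def power_add mult.assoc)
      moreover have "k + s \<le> M"
        using k by (simp add: M_def)
      ultimately show "d (k + s) * bernstein_basis a b M (k + s) x
          = (x - a) ^ s * (b - x) ^ t * (c k * bernstein_basis a b N k x)"
        using k assms(1) unfolding bernstein_basis_def d_def
        by (simp add: power_add[of _ k s])
    qed simp
    finally show "poly ([:-a, 1:] ^ s * [:b, -1:] ^ t * bernstein_comb a b N c) x
        = poly (bernstein_comb a b M d) x"
      by (simp add: poly_bernstein_comb sum_distrib_left algebra_simps)
  qed
  moreover have "d k > 0" if "s \<le> k" "k + t \<le> N + s + t" for k
    using that pos[of "k - s"] assms(1) by (simp add: d_def M_def)
  moreover have "d k \<ge> 0" for k
    using calculation(2)[of k] by (cases "s \<le> k \<and> k \<le> N + s") (auto simp: d_def less_imp_le)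
  ultimately show ?thesis
    unfolding M_def by blast
qed

lemma factor_endpoints:
  fixes q :: "real poly"
  assumes "a < b" and pos: "\<And>x. x \<in> {a<..<b} \<Longrightarrow> poly q x > 0"
  obtains h where "q = [:-a, 1:] ^ order a q * [:b, -1:] ^ order b q * h"
    and "\<And>x. x \<in> {a..b} \<Longrightarrow> poly h x > 0"
proof -
  have "poly q ((a + b) / 2) > 0"
    using assms(1) by (intro pos) auto
  then have "q \<noteq> 0" by auto
  then obtain h1 where h1: "q = [:-a, 1:] ^ order a q * h1" "\<not> [:-a, 1:] dvd h1"
    using order_decomp by blast
  have "h1 \<noteq> 0"
    using h1(2) by auto
  then obtain h2 where h2: "h1 = [:-b, 1:] ^ order b h1 * h2" "\<not> [:-b, 1:] dvd h2"
    using order_decomp by blast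
  have "order b ([:-a, 1:] ^ order a q) = 0"
    using assms(1) by (intro order_0I) simp
  then have ord: "order b h1 = order b q"
    using order_mult[of "[:-a, 1:] ^ order a q" h1 b] h1(1) \<open>q \<noteq> 0\<close> by simp
  \<comment> \<open>The sign accounts for replacing \<open>x - b\<close> by \<open>b - x\<close>.\<close>
  define h where "h = smult ((-1) ^ order b q) h2"
  have "[:b, -1:] ^ n = smult ((-1) ^ n) ([:-b, 1:] ^ n)" for n
    by (simp flip: smult_power)
  then have q: "q = [:-a, 1:] ^ order a q * [:b, -1:] ^ order b q * h"
    using h1(1) h2(1) unfolding ord h_def
    by (simp add: mult.assoc flip: power_mult_distrib)
  have hpos: "poly h x > 0" if "x \<in> {a<..<b}" for x
  proof -
    have "poly q x = (x - a) ^ order a q * (b - x) ^ order b q * poly h x"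
      by (subst q) simp
    moreover have "(x - a) ^ order a q * (b - x) ^ order b q > 0"
      using that by simp
    ultimately show ?thesis
      using pos[OF that] by (metis zero_less_mult_pos)
  qed
  have h0: "poly h a \<noteq> 0" "poly h b \<noteq> 0"
  proof -
    have "poly h1 a \<noteq> 0" "poly h2 b \<noteq> 0"
      using h1(2) h2(2) by (simp_all add: poly_eq_0_iff_dvd)
    moreover from this(1) have "poly h2 a \<noteq> 0"
      by (metis h2(1) mult_zero_right poly_mult)
    ultimately show "poly h a \<noteq> 0" "poly h b \<noteq> 0"
      by (simp_all add: h_def)
  qed
  have "poly h x \<ge> 0" if "x \<in> {a..b}" for x
  proof (rule continuous_ge_on_closure[of "{a<..<b}" "poly h"])
    show "x \<in> closure {a<..<b}"
      using that assms(1) by simp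
  qed (auto intro!: continuous_intros simp: hpos less_imp_le)
  then have "poly h x > 0" if "x \<in> {a..b}" for x
    using that h0 hpos[of x]
    by (cases "x = a"; cases "x = b") (auto simp: less_le)
  with q show thesis by (rule that)
qed

lemma bernstein_coeffs_pos_interior:
  assumes "a < b" and pos: "\<And>x. x \<in> {a<..<b} \<Longrightarrow> poly q x > 0"
  shows "\<forall>\<^sub>F N in sequentially. \<exists>c. q = bernstein_comb a b N c \<and> (\<forall>k\<le>N. c k \<ge> 0)
           \<and> (\<forall>k. order a q \<le> k \<longrightarrow> k + order b q \<le> N \<longrightarrow> c k > 0)"
proof -
  define s t where "s = order a q" and "t = order b q"
  obtain h where q: "q = [:-a, 1:] ^ s * [:b, -1:] ^ t * h"
    and h: "\<And>x. x \<in> {a..b} \<Longrightarrow> poly h x > 0"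
    using factor_endpoints[OF assms] unfolding s_def t_def by blast
  obtain N0 where N0: "\<And>N. N \<ge> N0 \<Longrightarrow> \<exists>c. h = bernstein_comb a b N c \<and> (\<forall>k\<le>N. c k > 0)"
    using bernstein_coeffs_pos[OF assms(1) h] by (auto simp: eventually_sequentially)
  have "\<exists>c. q = bernstein_comb a b N c \<and> (\<forall>k\<le>N. c k \<ge> 0)
           \<and> (\<forall>k. s \<le> k \<longrightarrow> k + t \<le> N \<longrightarrow> c k > 0)" if "N \<ge> N0 + s + t" for N
  proof -
    define M where "M = N - s - t"
    have N: "N = M + s + t" and "M \<ge> N0"
      using that by (simp_all add: M_def)
    from N0[OF this(2)] obtain c where c: "h = bernstein_comb a b M c" "\<And>k. k \<le> M \<Longrightarrow> c k > 0"
      by blast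
    show ?thesis
      using bernstein_comb_mult[where s = s and t = t, OF assms(1) c(2)]
      unfolding N q c(1) by simp
  qed
  then show ?thesis
    unfolding s_def[symmetric] t_def[symmetric] eventually_sequentially by blast
qed

section \<open>Coefficients of the derivative\<close>

lemma pderiv_bernstein_poly_0:
  assumes "a \<noteq> b"
  shows "pderiv (bernstein_poly a b (Suc M) 0) = smult (- (real (Suc M) / (b - a))) (bernstein_poly a b M 0)"
proof -
  have "pderiv ([:b, -1:] ^ Suc M) = smult (- real (Suc M)) ([:b, -1:] ^ M)"
    by (simp add: pderiv_power_Suc pderiv_pCons del: power_Suc of_nat_Suc)
  then show ?thesis
    by (simp add: bernstein_poly_def pderiv_smult del: power_Suc of_nat_Suc) simp
qed

lemma pderiv_bernstein_poly_Suc: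
  assumes "a \<noteq> b" "k \<le> M"
  shows "pderiv (bernstein_poly a b (Suc M) (Suc k))
    = smult (real (Suc M) / (b - a)) (bernstein_poly a b M k - bernstein_poly a b M (Suc k))"
proof -
  let ?X = "[:-a, 1:]" and ?V = "[:b, -1:]"
  define w where "w = real (Suc M choose Suc k) / (b - a) ^ Suc M"
  have w0: "w * real (Suc k) = real (Suc M) / (b - a) * (real (M choose k) / (b - a) ^ M)"
  proof -
    have "real (Suc M choose Suc k) * real (Suc k) = real (Suc M) * real (M choose k)"
      using Suc_times_binomial_eq[of M k] by (metis of_nat_mult mult.commute)
    then show ?thesis
      by (simp add: w_def field_simps del: binomial_Suc_Suc of_nat_Suc)
  qed
  have w1: "w * real (M - k) = real (Suc M) / (b - a) * (real (M choose Suc k) / (b - a) ^ M)"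
  proof -
    have "real (Suc M choose Suc k) * real (M - k) = real (Suc M) * real (M choose Suc k)"
      using binomial_absorb_comp[of "Suc M" "Suc k"] by (metis diff_Suc_1 diff_Suc_Suc of_nat_mult mult.commute)
    then show ?thesis
      by (simp add: w_def field_simps del: binomial_Suc_Suc of_nat_Suc)
  qed
  have V: "pderiv (?V ^ (M - k)) = smult (- real (M - k)) (?V ^ (M - Suc k))"
  proof (cases "M - k")
    case (Suc n)
    then have "M - Suc k = n" by simp
    with Suc show ?thesis
      by (simp add: pderiv_power_Suc pderiv_pCons del: power_Suc of_nat_Suc)
  qed simp
  have X: "pderiv (?X ^ Suc k) = smult (real (Suc k)) (?X ^ k)"
    by (simp add: pderiv_power_Suc pderiv_pCons del: power_Suc of_nat_Suc)
  have p: "bernstein_poly a b (Suc M) (Suc k) = smult w (?X ^ Suc k * ?V ^ (M - k))"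
    by (simp only: bernstein_poly_def w_def diff_Suc_Suc)
  have "pderiv (bernstein_poly a b (Suc M) (Suc k))
      = smult (w * real (Suc k)) (?X ^ k * ?V ^ (M - k))
        - smult (w * real (M - k)) (?X ^ Suc k * ?V ^ (M - Suc k))"
    unfolding p pderiv_smult pderiv_mult V X
    by (rule poly_ext)
       (simp only: poly_smult poly_mult poly_add poly_diff, simp only: algebra_simps mult_minus_left mult_minus_right)
  then show ?thesis
    unfolding w0 w1 bernstein_poly_def by (simp only: smult_diff_right smult_smult)
qed

lemma pderiv_bernstein_comb:
  assumes "a \<noteq> b"
  shows "pderiv (bernstein_comb a b (Suc M) c)
    = bernstein_comb a b M (\<lambda>k. real (Suc M) / (b - a) * (c (Suc k) - c k))"
proof -
  define r where "r = real (Suc M) / (b - a)"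
  let ?p = "bernstein_poly a b M"
  have "pderiv (bernstein_comb a b (Suc M) c)
      = smult (c 0) (pderiv (bernstein_poly a b (Suc M) 0))
        + (\<Sum>k\<le>M. smult (c (Suc k)) (pderiv (bernstein_poly a b (Suc M) (Suc k))))"
    unfolding bernstein_comb_def sum.atMost_Suc_shift
    by (simp only: pderiv_add pderiv_smult higher_pderiv_sum[of 1, simplified])
  also have "\<dots> = smult (c 0) (smult (- r) (?p 0))
        + (\<Sum>k\<le>M. smult (c (Suc k)) (smult r (?p k - ?p (Suc k))))"
    using pderiv_bernstein_poly_0[OF assms] pderiv_bernstein_poly_Suc[OF assms]
    unfolding r_def by (intro arg_cong2[where f = "(+)"] sum.cong) auto
  also have "\<dots> = smult r ((\<Sum>k\<le>M. smult (c (Suc k)) (?p k))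
      - (smult (c 0) (?p 0) + (\<Sum>k\<le>M. smult (c (Suc k)) (?p (Suc k)))))"
    by (rule poly_ext) (simp add: poly_sum algebra_simps sum_subtractf sum_distrib_left)
  also have "smult (c 0) (?p 0) + (\<Sum>k\<le>M. smult (c (Suc k)) (?p (Suc k)))
      = (\<Sum>k\<le>Suc M. smult (c k) (?p k))"
    by (rule sum.atMost_Suc_shift[symmetric])
  \<comment> \<open>The last term drops out, since \<open>?p (Suc M)\<close> contains the factor \<open>M choose Suc M = 0\<close>.\<close>
  also have "\<dots> = bernstein_comb a b M c"
    by (simp add: bernstein_comb_def bernstein_poly_def)
  also have "smult r ((\<Sum>k\<le>M. smult (c (Suc k)) (?p k)) - bernstein_comb a b M c)
      = bernstein_comb a b M (\<lambda>k. r * (c (Suc k) - c k))"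
    unfolding bernstein_comb_scale bernstein_comb_diff by (simp only: bernstein_comb_def)
  finally show ?thesis
    unfolding r_def .
qed

lemma pderiv_pos_imp_coeffs_less:
  assumes "a < b" and pos: "\<And>x. x \<in> {a<..<b} \<Longrightarrow> poly (pderiv f) x > 0"
  shows "\<forall>\<^sub>F N in sequentially. \<forall>c. f = bernstein_comb a b N c \<longrightarrow>
           strict_mono_on {k. order a (pderiv f) \<le> k \<and> k + order b (pderiv f) \<le> N} c"
proof -
  define s t where "s = order a (pderiv f)" and "t = order b (pderiv f)"
  obtain N0 where N0: "\<And>N. N \<ge> N0 \<Longrightarrow> \<exists>d. pderiv f = bernstein_comb a b N d
      \<and> (\<forall>k\<le>N. d k \<ge> 0) \<and> (\<forall>k. s \<le> k \<longrightarrow> k + t \<le> N \<longrightarrow> d k > 0)"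
    using bernstein_coeffs_pos_interior[OF assms]
    unfolding eventually_sequentially s_def t_def by blast
  have "strict_mono_on {k. s \<le> k \<and> k + t \<le> N} c"
    if large: "N \<ge> Suc N0" and f: "f = bernstein_comb a b N c" for N c
  proof -
    obtain M where N: "N = Suc M" and "M \<ge> N0"
      using Suc_le_D[OF large] large by auto
    obtain d where d: "pderiv f = bernstein_comb a b M d" "\<And>k. s \<le> k \<Longrightarrow> k + t \<le> M \<Longrightarrow> d k > 0"
      using N0[OF \<open>M \<ge> N0\<close>] by blast
    have step: "c k < c (Suc k)" if "s \<le> k" "k + t \<le> M" for k
    proof -
      have "bernstein_comb a b M (\<lambda>k. real (Suc M) / (b - a) * (c (Suc k) - c k))
          = bernstein_comb a b M d"
        using pderiv_bernstein_comb[of a b M c] assms(1) d(1) f N by simp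
      then have "real (Suc M) / (b - a) * (c (Suc k) - c k) = d k"
        by (rule bernstein_comb_unique[rotated]) (use assms(1) that in auto)
      then have "real (Suc M) / (b - a) * (c (Suc k) - c k) > 0"
        using d(2) that by simp
      then show ?thesis
        using assms(1) by (simp add: zero_less_mult_iff zero_less_divide_iff)
    qed
    have "c i < c j" if "i < j" "s \<le> i" "j + t \<le> N" for i j
      using that
    proof (induction j)
      case (Suc j)
      then show ?case
        using step[of j] N by (cases "i = j") auto
    qed simp
    then show ?thesis
      by (auto simp: strict_mono_on_def)
  qed
  then show ?thesis
    unfolding eventually_sequentially s_def t_def by blast
qed

lemma coeffs_mono_imp_pderiv_pos:
  assumes "pderiv f \<noteq> 0" "f = bernstein_comb a b N c" "mono_on {..N} c" "x \<in> {a<..<b}"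
  shows "poly (pderiv f) x > 0"
proof -
  have ab: "a < b" "a \<noteq> b"
    using assms(4) by auto
  obtain M where N: "N = Suc M"
  proof (cases N)
    case 0
    then show ?thesis
      using assms(1,2) by (simp add: bernstein_comb_def bernstein_poly_def)
  qed blast
  define d where "d k = real (Suc M) / (b - a) * (c (Suc k) - c k)" for k
  have f': "pderiv f = bernstein_comb a b M d"
    using pderiv_bernstein_comb[OF ab(2), of M c] assms(2) N by (simp add: d_def[abs_def])
  have nonneg: "d k \<ge> 0" if "k \<le> M" for k
  proof -
    have "c k \<le> c (Suc k)"
      using that N by (intro mono_onD[OF assms(3)]) auto
    then show ?thesis
      using ab(1) by (simp add: d_def)
  qed
  obtain k where k: "k \<le> M" "d k \<noteq> 0"
    using assms(1) f' unfolding bernstein_comb_def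
    by (metis (no_types, lifting) atMost_iff smult_0_left sum.neutral)
  have "(\<Sum>k\<le>M. d k * bernstein_basis a b M k x) > 0"
  proof (rule sum_pos2[of _ k])
    show "0 < d k * bernstein_basis a b M k x"
      using k nonneg[of k] bernstein_basis_pos[of a x b k M] assms(4) by simp
    show "0 \<le> d i * bernstein_basis a b M i x" if "i \<in> {..M}" for i
      using that nonneg[of i] bernstein_basis_pos[of a x b i M] assms(4) by simp
  qed (use k in auto)
  then show ?thesis
    by (simp add: f' poly_bernstein_comb)
qed

text \<open>
  The bound \<open>k \<le> N\<close> is part of the conclusion: the order of \<open>a\<close> in \<open>pderiv f\<close> is smaller than the
  degree of \<open>f\<close>. Only \<open>a \<noteq> b\<close> is assumed, so the lemma also serves the right endpoint.
\<close>

lemma coeffs_eq_at_zero_of_pderiv: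
  assumes "a \<noteq> b" "pderiv f \<noteq> 0" "f = bernstein_comb a b N c" "k \<le> order a (pderiv f)"
  shows "k \<le> N \<and> c k = poly f a"
proof -
  define g where "g = f - [:poly f a:]"
  have g': "pderiv g = pderiv f"
    by (simp add: g_def pderiv_diff)
  then have "g \<noteq> 0"
    using assms(2) by auto
  moreover have "poly g a = 0"
    by (simp add: g_def)
  ultimately have "order a g = Suc (order a (pderiv f))"
    using order_pderiv[of g a] assms(2) g' order_root[of g a] by simp
  then have dvd: "[:-a, 1:] ^ Suc (order a (pderiv f)) dvd g"
    using order_1 by metis
  have g: "g = bernstein_comb a b N (\<lambda>k. c k - poly f a)"
    using assms(1,3) by (simp add: g_def bernstein_comb_diff bernstein_comb_const)
  have zero: "c j - poly f a = 0" if "j \<le> order a (pderiv f)" "j \<le> N" for j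
    using bernstein_comb_coeff_eq_0[OF assms(1) dvd[unfolded g], of j] that by simp
  have "order a (pderiv f) \<le> N"
  proof (rule ccontr)
    assume "\<not> order a (pderiv f) \<le> N"
    then have "g = bernstein_comb a b N (\<lambda>_. 0)"
      unfolding g by (intro bernstein_comb_cong zero) auto
    then show False
      using \<open>g \<noteq> 0\<close> by (simp add: bernstein_comb_def)
  qed
  then show ?thesis
    using zero[of k] assms(4) by simp
qed

section \<open>Operators fixing the constants and a polynomial\<close>

lemma poly_eqI_interval:
  fixes p q :: "real poly"
  assumes "a < b" "\<And>x. x \<in> {a..b} \<Longrightarrow> poly p x = poly q x"
  shows "p = q"
proof (rule ccontr)
  assume "p \<noteq> q"
  then have "finite {x. poly (p - q) x = 0}"
    by (intro poly_roots_finite) simp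
  then have "finite {a..b}"
    by (rule rev_finite_subset) (auto simp: assms(2))
  then show False
    using infinite_Icc[OF assms(1)] by blast
qed

lemma poly_strict_mono_on:
  fixes f :: "real poly"
  assumes "degree f > 0" "\<forall>x\<in>{a..b}. poly (pderiv f) x \<ge> 0"
  shows "strict_mono_on {a..b} (poly f)"
proof (rule strict_mono_onI)
  have mono: "poly f x \<le> poly f y" if "a \<le> x" "x \<le> y" "y \<le> b" for x y
    by (rule DERIV_nonneg_imp_nondecreasing[of x y "poly f"])
       (use that assms(2) in \<open>auto intro!: exI poly_DERIV\<close>)
  fix x y assume xy: "x \<in> {a..b}" "y \<in> {a..b}" "x < y"
  show "poly f x < poly f y"
  proof (rule ccontr)
    assume neg: "\<not> poly f x < poly f y"
    have "f = [:poly f x:]"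
    proof (rule poly_eqI_interval[OF xy(3)])
      fix z assume "z \<in> {x..y}"
      then show "poly f z = poly [:poly f x:] z"
        using mono[of x z] mono[of z y] neg xy by simp
    qed
    then show False
      using assms(1) by (metis degree_pCons_0 less_irrefl)
  qed
qed

text \<open>
  The nodes of operators fixing \<open>1\<close> and \<open>f\<close> are exactly the points of \<open>[a,b]\<close> at which \<open>f\<close> takes its
  Bernstein coefficients as values.
\<close>

lemma is_bernstein_fixing_iff:
  assumes "a < b"
  shows "(\<exists>B. is_bernstein_fixing a b N f B t) \<longleftrightarrow>
    (\<forall>k\<le>N. t k \<in> {a..b}) \<and> f = bernstein_comb a b N (\<lambda>k. poly f (t k))"
proof
  assume "\<exists>B. is_bernstein_fixing a b N f B t"
  then obtain B \<alpha> where t: "\<And>k. k \<le> N \<Longrightarrow> t k \<in> {a..b}"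
    and B: "\<And>g x. continuous_on {a..b} g \<Longrightarrow> x \<in> {a..b} \<Longrightarrow>
           B g x = (\<Sum>k\<le>N. g (t k) * \<alpha> k * bernstein_basis a b N k x)"
    and fix1: "\<And>x. x \<in> {a..b} \<Longrightarrow> B (\<lambda>_. 1) x = 1"
    and fixf: "\<And>x. x \<in> {a..b} \<Longrightarrow> B (poly f) x = poly f x"
    unfolding is_bernstein_fixing_def gen_bernstein_op_def op_fixes_def by blast
  have "bernstein_comb a b N \<alpha> = 1"
    using B[of "\<lambda>_. 1"] fix1
    by (intro poly_eqI_interval[OF assms]) (simp add: poly_bernstein_comb)
  also have "\<dots> = bernstein_comb a b N (\<lambda>_. 1)"
    using assms by (simp add: bernstein_comb_const)
  finally have \<alpha>: "\<alpha> k = 1" if "k \<le> N" for k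
    using bernstein_comb_unique[of a b N \<alpha> "\<lambda>_. 1" k] assms that by simp
  have "f = bernstein_comb a b N (\<lambda>k. poly f (t k) * \<alpha> k)"
    using B[of "poly f"] fixf
    by (intro poly_eqI_interval[OF assms]) (simp add: poly_bernstein_comb continuous_intros)
  also have "\<dots> = bernstein_comb a b N (\<lambda>k. poly f (t k))"
    by (rule bernstein_comb_cong) (simp add: \<alpha>)
  finally show "(\<forall>k\<le>N. t k \<in> {a..b}) \<and> f = bernstein_comb a b N (\<lambda>k. poly f (t k))"
    using t by blast
next
  assume *: "(\<forall>k\<le>N. t k \<in> {a..b}) \<and> f = bernstein_comb a b N (\<lambda>k. poly f (t k))"
  define B where "B g x = (\<Sum>k\<le>N. g (t k) * bernstein_basis a b N k x)" for g x
  have "gen_bernstein_op a b N B t (\<lambda>_. 1)"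
    using * by (simp add: gen_bernstein_op_def B_def)
  moreover have "B (\<lambda>_. 1) x = poly (bernstein_comb a b N (\<lambda>_. 1)) x" for x
    by (simp add: B_def poly_bernstein_comb)
  then have "B (\<lambda>_. 1) x = 1" for x
    using assms by (simp add: bernstein_comb_const)
  moreover have "B (poly f) x = poly f x" for x
    using arg_cong[OF conjunct2[OF *], of "\<lambda>p. poly p x"] by (simp add: B_def poly_bernstein_comb)
  ultimately show "\<exists>B. is_bernstein_fixing a b N f B t"
    unfolding is_bernstein_fixing_def op_fixes_def by blast
qed

text \<open>
  For large \<open>N\<close> the coefficients of \<open>f - f a\<close> and of \<open>f b - f\<close> are nonnegative, so those of \<open>f\<close> lie in
  \<open>[f a, f b]\<close> and are attained by the intermediate value theorem.
\<close>

lemma eventually_is_bernstein_fixing: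
  assumes "a < b" and mono: "strict_mono_on {a..b} (poly f)"
  shows "\<forall>\<^sub>F N in sequentially. \<exists>B t. is_bernstein_fixing a b N f B t"
proof -
  have less: "poly f x < poly f y" if "x < y" "a \<le> x" "y \<le> b" for x y
    using strict_mono_onD[OF mono, of x y] that by simp
  have "\<forall>\<^sub>F N in sequentially. \<exists>c. f - [:poly f a:] = bernstein_comb a b N c \<and> (\<forall>k\<le>N. c k \<ge> 0)"
    using bernstein_coeffs_pos_interior[OF assms(1), of "f - [:poly f a:]"] less[of a]
    by (auto elim: eventually_mono)
  moreover have
    "\<forall>\<^sub>F N in sequentially. \<exists>c. [:poly f b:] - f = bernstein_comb a b N c \<and> (\<forall>k\<le>N. c k \<ge> 0)"
    using bernstein_coeffs_pos_interior[OF assms(1), of "[:poly f b:] - f"] less[of _ b]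
    by (auto elim: eventually_mono)
  ultimately show ?thesis
  proof eventually_elim
    case (elim N)
    obtain c where c: "f - [:poly f a:] = bernstein_comb a b N c" "\<And>k. k \<le> N \<Longrightarrow> c k \<ge> 0"
      using elim by blast
    obtain d where d: "[:poly f b:] - f = bernstein_comb a b N d" "\<And>k. k \<le> N \<Longrightarrow> d k \<ge> 0"
      using elim by blast
    have ab: "a \<noteq> b" using assms(1) by simp
    define \<gamma> where "\<gamma> k = poly f b - d k" for k
    have f: "f = bernstein_comb a b N \<gamma>"
      unfolding \<gamma>_def bernstein_comb_diff d(1)[symmetric] bernstein_comb_const[OF ab] by simp
    have "bernstein_comb a b N c = bernstein_comb a b N (\<lambda>k. \<gamma> k - poly f a)"
      unfolding bernstein_comb_diff c(1)[symmetric] bernstein_comb_const[OF ab] f[symmetric] by simp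
    then have c': "c k = \<gamma> k - poly f a" if "k \<le> N" for k
      using bernstein_comb_unique[OF ab] that by blast
    have "\<exists>x\<in>{a..b}. poly f x = \<gamma> k" if "k \<le> N" for k
    proof -
      have "poly f a \<le> \<gamma> k" "\<gamma> k \<le> poly f b"
        using c(2)[OF that] c'[OF that] d(2)[OF that] by (simp_all add: \<gamma>_def)
      moreover have "continuous_on {a..b} (poly f)"
        by (intro continuous_intros)
      ultimately show ?thesis
        using IVT'[of "poly f" a "\<gamma> k" b] assms(1) by auto
    qed
    then obtain t where t: "\<And>k. k \<le> N \<Longrightarrow> t k \<in> {a..b} \<and> poly f (t k) = \<gamma> k"
      by metis
    then have "f = bernstein_comb a b N (\<lambda>k. poly f (t k))"
      using f bernstein_comb_cong[of N \<gamma> "\<lambda>k. poly f (t k)" a b] by simp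
    then show ?case
      using is_bernstein_fixing_iff[OF assms(1)] t by blast
  qed
qed

theorem theorem5p1:
  fixes a b :: real and f1 :: "real poly"
  assumes "a < b"
    and "degree f1 > 0"
    and "\<forall>x\<in>{a..b}. poly (pderiv f1) x \<ge> 0"
  shows
    "(\<forall>\<^sub>F N in sequentially. \<exists>B t. is_bernstein_fixing a b N f1 B t)
     \<and> ((\<exists>x0\<in>{a<..<b}. poly (pderiv f1) x0 = 0) \<longrightarrow>
          (\<forall>N B t. is_bernstein_fixing a b N f1 B t \<longrightarrow> \<not> mono_on {..N} t))
     \<and> (\<forall>N B t s1 s2. is_bernstein_fixing a b N f1 B t \<longrightarrow>
          (order a (pderiv f1) = s1 \<longrightarrow> (\<forall>k\<le>s1. t k = a)) \<and>
          (order b (pderiv f1) = s2 \<longrightarrow> (\<forall>k\<le>N. N \<le> k + s2 \<longrightarrow> t k = b)))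
     \<and> ((\<forall>x\<in>{a<..<b}. poly (pderiv f1) x > 0) \<longrightarrow>
          (\<forall>\<^sub>F N in sequentially. \<forall>B t. is_bernstein_fixing a b N f1 B t \<longrightarrow>
             strict_mono_on {k. k \<le> N \<and> t k \<in> {a<..<b}} t))
     \<and> ((\<forall>x\<in>{a..b}. poly (pderiv f1) x > 0) \<longrightarrow>
          (\<forall>\<^sub>F N in sequentially. \<forall>B t. is_bernstein_fixing a b N f1 B t \<longrightarrow>
             strict_mono_on {..N} t))"
proof -
  note ab = assms(1)
  have "pderiv f1 \<noteq> 0"
    using assms(2) by (simp add: pderiv_eq_0_iff)
  have mono: "strict_mono_on {a..b} (poly f1)"
    using assms(2,3) by (rule poly_strict_mono_on)
  have nodes: "t k \<in> {a..b}" if "is_bernstein_fixing a b N f1 B t" "k \<le> N" for N B t k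
    using is_bernstein_fixing_iff[OF ab] that by blast
  have coeffs: "f1 = bernstein_comb a b N (\<lambda>k. poly f1 (t k))"
    if "is_bernstein_fixing a b N f1 B t" for N B t
    using is_bernstein_fixing_iff[OF ab] that by blast
  have less: "t i < t j"
    if "is_bernstein_fixing a b N f1 B t" "i \<le> N" "j \<le> N" "poly f1 (t i) < poly f1 (t j)" for N B t i j
    using strict_mono_on_less[OF mono] nodes that by blast
  have left: "t k = a"
    if fx: "is_bernstein_fixing a b N f1 B t" and k: "k \<le> order a (pderiv f1)" for N B t k
  proof -
    have "k \<le> N \<and> poly f1 (t k) = poly f1 a"
      using coeffs_eq_at_zero_of_pderiv[OF _ \<open>pderiv f1 \<noteq> 0\<close> coeffs[OF fx] k] ab by simp
    then show ?thesis
      using strict_mono_on_eqD[OF mono, of "t k" a] nodes[OF fx] ab by auto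
  qed
  have right: "t k = b"
    if fx: "is_bernstein_fixing a b N f1 B t" and k: "k \<le> N" "N \<le> k + order b (pderiv f1)"
    for N B t k
  proof -
    have "f1 = bernstein_comb b a N (\<lambda>k. poly f1 (t (N - k)))"
      using coeffs[OF fx] unfolding bernstein_comb_swap[of a b N] .
    from coeffs_eq_at_zero_of_pderiv[OF _ \<open>pderiv f1 \<noteq> 0\<close> this, of "N - k"]
    have "poly f1 (t (N - (N - k))) = poly f1 b"
      using ab k by simp
    then show ?thesis
      using strict_mono_on_eqD[OF mono, of "t k" b] nodes[OF fx] ab k by auto
  qed
  have strict: "\<forall>\<^sub>F N in sequentially. \<forall>B t. is_bernstein_fixing a b N f1 B t \<longrightarrow>
      strict_mono_on {k. order a (pderiv f1) \<le> k \<and> k + order b (pderiv f1) \<le> N} t"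
    if "\<forall>x\<in>{a<..<b}. poly (pderiv f1) x > 0"
  proof (rule eventually_mono[OF pderiv_pos_imp_coeffs_less[OF ab, of f1]])
    show "poly (pderiv f1) x > 0" if "x \<in> {a<..<b}" for x
      using \<open>\<forall>x\<in>{a<..<b}. poly (pderiv f1) x > 0\<close> that by blast
  next
    fix N
    assume c: "\<forall>c. f1 = bernstein_comb a b N c \<longrightarrow>
      strict_mono_on {k. order a (pderiv f1) \<le> k \<and> k + order b (pderiv f1) \<le> N} c"
    show "\<forall>B t. is_bernstein_fixing a b N f1 B t \<longrightarrow>
      strict_mono_on {k. order a (pderiv f1) \<le> k \<and> k + order b (pderiv f1) \<le> N} t"
    proof (intro allI impI strict_mono_onI)
      fix B t i j
      assume fx: "is_bernstein_fixing a b N f1 B t"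
        and i: "i \<in> {k. order a (pderiv f1) \<le> k \<and> k + order b (pderiv f1) \<le> N}"
        and j: "j \<in> {k. order a (pderiv f1) \<le> k \<and> k + order b (pderiv f1) \<le> N}"
        and "i < j"
      from c coeffs[OF fx] have "strict_mono_on
          {k. order a (pderiv f1) \<le> k \<and> k + order b (pderiv f1) \<le> N} (\<lambda>k. poly f1 (t k))"
        by blast
      from strict_mono_onD[OF this i j \<open>i < j\<close>] have "poly f1 (t i) < poly f1 (t j)" .
      then show "t i < t j"
        using less[OF fx] i j by simp
    qed
  qed
  show ?thesis
  proof (intro conjI impI allI)
    show "\<forall>\<^sub>F N in sequentially. \<exists>B t. is_bernstein_fixing a b N f1 B t"
      using ab mono by (rule eventually_is_bernstein_fixing)
  next
    fix N B t
    assume x0: "\<exists>x0\<in>{a<..<b}. poly (pderiv f1) x0 = 0" and fx: "is_bernstein_fixing a b N f1 B t"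
    show "\<not> mono_on {..N} t"
    proof
      assume "mono_on {..N} t"
      then have "mono_on {..N} (\<lambda>k. poly f1 (t k))"
        using strict_mono_on_leD[OF mono] nodes[OF fx] by (auto simp: mono_on_def)
      then show False
        using x0 coeffs_mono_imp_pderiv_pos[OF \<open>pderiv f1 \<noteq> 0\<close> coeffs[OF fx]] by force
    qed
  next
    fix N B t s1 k
    assume "is_bernstein_fixing a b N f1 B t" "order a (pderiv f1) = s1" "k \<le> s1"
    then show "t k = a"
      using left by blast
  next
    fix N B t s2 k
    assume "is_bernstein_fixing a b N f1 B t" "order b (pderiv f1) = s2" "k \<le> N" "N \<le> k + s2"
    then show "t k = b"
      using right by blast
  next
    assume "\<forall>x\<in>{a<..<b}. poly (pderiv f1) x > 0"
    from strict[OF this]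
    show "\<forall>\<^sub>F N in sequentially. \<forall>B t. is_bernstein_fixing a b N f1 B t \<longrightarrow>
        strict_mono_on {k. k \<le> N \<and> t k \<in> {a<..<b}} t"
    proof (rule eventually_mono, intro allI impI)
      fix N B t
      assume *: "\<forall>B t. is_bernstein_fixing a b N f1 B t \<longrightarrow>
          strict_mono_on {k. order a (pderiv f1) \<le> k \<and> k + order b (pderiv f1) \<le> N} t"
        and fx: "is_bernstein_fixing a b N f1 B t"
      have "{k. k \<le> N \<and> t k \<in> {a<..<b}}
          \<subseteq> {k. order a (pderiv f1) \<le> k \<and> k + order b (pderiv f1) \<le> N}"
      proof
        fix k assume "k \<in> {k. k \<le> N \<and> t k \<in> {a<..<b}}"
        then have k: "k \<le> N" "t k \<noteq> a" "t k \<noteq> b"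
          by auto
        then show "k \<in> {k. order a (pderiv f1) \<le> k \<and> k + order b (pderiv f1) \<le> N}"
          using left[OF fx, of k] right[OF fx, of k]
          by (cases "k \<le> order a (pderiv f1)"; cases "N \<le> k + order b (pderiv f1)") auto
      qed
      then show "strict_mono_on {k. k \<le> N \<and> t k \<in> {a<..<b}} t"
        using * fx by (meson monotone_on_subset)
    qed
  next
    assume pos: "\<forall>x\<in>{a..b}. poly (pderiv f1) x > 0"
    have "poly (pderiv f1) a > 0" "poly (pderiv f1) b > 0"
      using pos ab by auto
    then have "order a (pderiv f1) = 0" "order b (pderiv f1) = 0"
      by (simp_all add: order_0I)
    moreover have "\<forall>x\<in>{a<..<b}. poly (pderiv f1) x > 0"
      using pos by simp
    ultimately show "\<forall>\<^sub>F N in sequentially. \<forall>B t. is_bernstein_fixing a b N f1 B t \<longrightarrow>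
        strict_mono_on {..N} t"
      using strict by (simp add: atMost_def)
  qed
qed

end
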